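(* Let $\pi\colon(X,T)\to(Y,S)$ be a factor map between minimal dynamical systems. Assume that $\pi$ is proximal and $n\geq 2$. Then $(X,T)$ is $n$-tuplewise thickly sensitive if and only if $(Y,S)$ is $n$-tuplewise thickly sensitive.
   Context: A dynamical system is a pair $(X,T)$ where $X$ is a compact metric space with metric $d$ and $T\colon X\to X$ is a continuous surjection. $\mathbb{N}$ is the set of positive integers. A subsystem is a non-empty closed $Y\subset X$ with $TY\subset Y$; a system is minimal if it has no proper subsystem. A factor map $\pi\colon(X,T)\to(Y,S)$ is a continuous surjection with $\pi\circ T=S\circ\pi$. A pair $(x,y)\in X^2$ is proximal if $\liminf_{k\to\infty}d(T^kx,T^ky)=0$. The factor map $\pi$ is proximal if every pair $(x,y)\in X^2$ with $\pi(x)=\pi(y)$ is proximal. A set $F\subset\mathbb{N}$ is thick if for every $L\in\mathbb{N}$ there is $m\in\mathbb{N}$ with $\{m,m+1,\dots,m+L\}\subset F$. $(X,T)$ is $n$-tuplewise thickly sensitive if there is a constant $\delta>0$ such that for every non-empty open $U\subset X$ there exist $x_1,\dots,x_n\in U$ such that $\{k\in\mathbb{N}: \min_{1\le i<j\le n}d(T^kx_i,T^kx_j)>\delta\}$ is thick. *)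

theory Defs
  imports "HOL-Analysis.Analysis"
begin

text \<open>
  A dynamical system is carried by a compact subset \<open>X\<close> of an ambient metric space, with the
  restricted metric and the subspace topology. The map \<open>T\<close> is a total function on the ambient type,
  but only its values on \<open>X\<close> (which it maps onto \<open>X\<close>) are relevant.
  The set of positive integers is rendered as \<open>{1..}\<close> in type \<open>nat\<close>.
\<close>

definition dynamical_system :: "'a::metric_space set \<Rightarrow> ('a \<Rightarrow> 'a) \<Rightarrow> bool" where
  "dynamical_system X T \<longleftrightarrow> compact X \<and> continuous_on X T \<and> T ` X = X"

definition subsystem :: "'a::metric_space set \<Rightarrow> 'a set \<Rightarrow> ('a \<Rightarrow> 'a) \<Rightarrow> bool" where
  "subsystem Z X T \<longleftrightarrow> Z \<noteq> {} \<and> closedin (top_of_set X) Z \<and> T ` Z \<subseteq> Z"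

definition minimal_system :: "'a::metric_space set \<Rightarrow> ('a \<Rightarrow> 'a) \<Rightarrow> bool" where
  "minimal_system X T \<longleftrightarrow> dynamical_system X T \<and> \<not> (\<exists>Z. subsystem Z X T \<and> Z \<noteq> X)"

definition factor_map ::
    "('a::metric_space \<Rightarrow> 'b::metric_space) \<Rightarrow> 'a set \<Rightarrow> ('a \<Rightarrow> 'a) \<Rightarrow> 'b set \<Rightarrow> ('b \<Rightarrow> 'b) \<Rightarrow> bool"
  where
  "factor_map p X T Y S \<longleftrightarrow>
     continuous_on X p \<and> p ` X = Y \<and> (\<forall>x\<in>X. p (T x) = S (p x))"

text \<open>The type \<open>real\<close> is not a complete lattice, so the limit inferior is taken in \<open>ereal\<close>.\<close>

definition proximal_pair :: "('a::metric_space \<Rightarrow> 'a) \<Rightarrow> 'a \<Rightarrow> 'a \<Rightarrow> bool" where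
  "proximal_pair T x y \<longleftrightarrow> liminf (\<lambda>k. ereal (dist ((T ^^ k) x) ((T ^^ k) y))) = 0"

definition proximal_map ::
    "('a::metric_space \<Rightarrow> 'b) \<Rightarrow> 'a set \<Rightarrow> ('a \<Rightarrow> 'a) \<Rightarrow> bool" where
  "proximal_map p X T \<longleftrightarrow> (\<forall>x\<in>X. \<forall>y\<in>X. p x = p y \<longrightarrow> proximal_pair T x y)"

definition thick :: "nat set \<Rightarrow> bool" where
  "thick F \<longleftrightarrow> (\<forall>L\<ge>1. \<exists>m\<ge>1. {m..m + L} \<subseteq> F)"

text \<open>
  Tuples are functions on \<open>nat\<close> of which only the values at \<open>1, \<dots>, n\<close> are used. The notion is
  meant for \<open>n \<ge> 2\<close>: then the set under \<open>Min\<close> is finite and non-empty, so \<open>Min\<close> is the true minimum.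
\<close>

definition tuplewise_thickly_sensitive ::
    "nat \<Rightarrow> 'a::metric_space set \<Rightarrow> ('a \<Rightarrow> 'a) \<Rightarrow> bool" where
  "tuplewise_thickly_sensitive n X T \<longleftrightarrow>
     (\<exists>\<delta>::real. \<delta> > 0 \<and>
       (\<forall>U. openin (top_of_set X) U \<and> U \<noteq> {} \<longrightarrow>
         (\<exists>x :: nat \<Rightarrow> 'a. (\<forall>i\<in>{1..n}. x i \<in> U) \<and>
            thick {k. k \<ge> 1 \<and>
              Min {dist ((T ^^ k) (x i)) ((T ^^ k) (x j)) | i j. 1 \<le> i \<and> i < j \<and> j \<le> n} > \<delta>})))"

end

theory Submission
  imports Defs
begin

text \<open>
  If the factor is sensitive, minimality and compactness cover \<open>Y\<close> by finitely many closed sets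
  \<open>S\<^sup>-\<^sup>k (p K)\<close>, for a compact \<open>K\<close> with interior inside a given open \<open>U\<close>. One of them contains
  an open set \<open>V\<close>; a separated tuple in \<open>V\<close>, shifted by \<open>k\<close>, lifts to a separated tuple in \<open>U\<close>.

  Conversely, proximality and compactness of \<open>X \<times> X\<close> give an \<open>N\<close> such that any two points with
  images at distance at most \<open>1 / (N + 1)\<close> come \<open>\<delta>\<close>-close within \<open>N\<close> steps. So a tuple that stays
  \<open>\<delta>\<close>-separated over a long time interval has images that stay \<open>1 / (N + 1)\<close>-separated, except
  perhaps over the last \<open>N\<close> steps.
\<close>

section \<open>Separated tuples and thick sets\<close>

text \<open>Since n \<ge> 2, the pair (1, 2) contributes a distance, so the finite set is non-empty
  and \<open>Min\<close> is a genuine minimum.\<close>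

lemma Min_pair_dist_gt_iff:
  fixes f :: "nat \<Rightarrow> 'a::metric_space"
  assumes "n \<ge> 2"
  shows "Min {dist (f i) (f j) | i j. 1 \<le> i \<and> i < j \<and> j \<le> n} > \<delta> \<longleftrightarrow>
    (\<forall>i j. 1 \<le> i \<and> i < j \<and> j \<le> n \<longrightarrow> dist (f i) (f j) > \<delta>)"
proof -
  let ?D = "{dist (f i) (f j) | i j. 1 \<le> i \<and> i < j \<and> j \<le> n}"
  have "?D \<subseteq> (\<lambda>(i, j). dist (f i) (f j)) ` ({..n} \<times> {..n})" by force
  then have "finite ?D" by (rule finite_subset) simp
  moreover have "dist (f 1) (f 2) \<in> ?D" using assms by force
  ultimately show ?thesis by (subst Min_gr_iff) blast+
qed

text \<open>Asking \<open>F\<close> for an interval longer by \<open>c\<close> makes each of its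
  first L + 1 points the start of a block inside \<open>F\<close>. The slack \<open>c\<close>
  absorbs either the waiting time for proximality or a time shift.\<close>

lemma thick_from_blocks:
  assumes "thick F" and "\<And>k. k \<ge> 1 \<Longrightarrow> {k..k + c} \<subseteq> F \<Longrightarrow> k \<in> G"
  shows "thick G"
  unfolding thick_def
proof (intro allI impI)
  fix L :: nat
  assume "L \<ge> 1"
  then have "L + c \<ge> 1" by simp
  then obtain m where m: "m \<ge> 1" "{m..m + (L + c)} \<subseteq> F"
    using assms(1) unfolding thick_def by blast
  have "k \<in> G" if "k \<in> {m..m + L}" for k
  proof (rule assms(2))
    show "k \<ge> 1" using that m(1) by simp
    have "{k..k + c} \<subseteq> {m..m + (L + c)}" using that by auto
    then show "{k..k + c} \<subseteq> F" using m(2) by blast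
  qed
  then show "\<exists>m\<ge>1. {m..m + L} \<subseteq> G" using m(1) by blast
qed

section \<open>Iterates on an invariant set\<close>

lemma funpow_mem:
  assumes "T ` X \<subseteq> X" "x \<in> X"
  shows "(T ^^ k) x \<in> X"
  using assms by (induction k) auto

lemma continuous_on_funpow:
  assumes "continuous_on X T" "T ` X \<subseteq> X"
  shows "continuous_on X (T ^^ k)"
proof (induction k)
  case (Suc k)
  have "(T ^^ k) ` X \<subseteq> X" using funpow_mem[OF assms(2)] by blast
  then have "continuous_on X (T \<circ> (T ^^ k))"
    using Suc continuous_on_compose continuous_on_subset[OF assms(1)] by blast
  then show ?case by simp
qed (simp add: id_def)

lemma factor_funpow:
  assumes "\<forall>x\<in>X. p (T x) = S (p x)" "T ` X \<subseteq> X" "x \<in> X"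
  shows "p ((T ^^ k) x) = (S ^^ k) (p x)"
proof (induction k)
  case (Suc k)
  then show ?case using assms(1) funpow_mem[OF assms(2,3), of k] by simp
qed simp

section \<open>Two covering arguments\<close>

lemma compact_increasing_open_cover:
  fixes U :: "nat \<Rightarrow> 'a::topological_space set"
  assumes "compact K" and "\<And>n. openin (top_of_set K) (U n)"
    and "mono U" and "K \<subseteq> (\<Union>n. U n)"
  shows "\<exists>n. K \<subseteq> U n"
proof -
  obtain D where D: "D \<subseteq> range U" "finite D" "K \<subseteq> \<Union>D"
    using assms(1,2,4) unfolding compact_eq_openin_cover by (metis imageE)
  then obtain I where I: "finite I" "D = U ` I" by (meson finite_subset_image)
  \<comment> \<open>If \<open>I\<close> is empty, \<open>Max I\<close> is unspecified, but then
    \<open>K\<close> is empty and any index serves.\<close>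
  have "U i \<subseteq> U (Max I)" if "i \<in> I" for i
    using that I(1) \<open>mono U\<close> by (simp add: monoD)
  then show ?thesis using D(3) I(2) by blast
qed

text \<open>A finite form of the Baire argument: either \<open>V\<close> lies inside the last closed
  set, or removing that set leaves a non-empty open set covered by the others.\<close>

lemma finite_closed_cover_contains_open:
  fixes C :: "nat \<Rightarrow> 'a::topological_space set"
  assumes "\<And>k. closedin (top_of_set Y) (C k)"
    and "openin (top_of_set Y) V" "V \<noteq> {}" "V \<subseteq> (\<Union>k<N. C k)"
  shows "\<exists>k W. openin (top_of_set Y) W \<and> W \<noteq> {} \<and> W \<subseteq> C k"
  using assms(2-4)
proof (induction N arbitrary: V)
  case (Suc N)
  show ?case
  proof (cases "V \<subseteq> C N")
    case True
    then show ?thesis using Suc.prems by blast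
  next
    case False
    have "openin (top_of_set Y) (V - C N)"
      using Suc.prems(1) assms(1) by (rule openin_diff)
    moreover have "V - C N \<subseteq> (\<Union>k<N. C k)"
      using Suc.prems(3) by (auto simp: lessThan_Suc)
    ultimately show ?thesis using Suc.IH[of "V - C N"] False by blast
  qed
qed simp

section \<open>Minimality and bounded hitting times\<close>

text \<open>The points whose orbits never meet \<open>U\<close> form a closed invariant proper
  subset, so by minimality there are none. Compactness then makes the hitting time bounded.\<close>

lemma minimal_hitting_time_bound:
  assumes "minimal_system X T" and U: "openin (top_of_set X) U" "U \<noteq> {}"
  shows "\<exists>N. \<forall>x\<in>X. \<exists>k\<le>N. (T ^^ k) x \<in> U"
proof -
  have comp: "compact X" and cont: "continuous_on X T" and TX: "T ` X \<subseteq> X"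
    using assms(1) by (auto simp: minimal_system_def dynamical_system_def)
  define V where "V N = (\<Union>k\<le>N. X \<inter> (T ^^ k) -` U)" for N
  have openV: "openin (top_of_set X) (V N)" for N
    unfolding V_def
  proof (intro openin_Union ballI, elim imageE, simp)
    fix k
    have "(T ^^ k) \<in> X \<rightarrow> X" using funpow_mem[OF TX] by auto
    then show "openin (top_of_set X) (X \<inter> (T ^^ k) -` U)"
      using continuous_openin_preimage[OF continuous_on_funpow[OF cont TX]] U(1) by blast
  qed
  have "mono V" unfolding V_def mono_def by fastforce
  define Z where "Z = X - (\<Union>N. V N)"
  have "closedin (top_of_set X) Z"
    unfolding Z_def using openV by (intro closedin_diff openin_Union) auto
  moreover have "T ` Z \<subseteq> Z"
  proof -
    have "T x \<in> Z" if "x \<in> Z" for x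
    proof -
      have "x \<in> X" "\<And>k. (T ^^ k) x \<notin> U"
        using that by (auto simp: Z_def V_def)
      then have "(T ^^ k) (T x) \<notin> U" for k
        by (metis comp_apply funpow_Suc_right)
      then show ?thesis using \<open>x \<in> X\<close> TX by (auto simp: Z_def V_def)
    qed
    then show ?thesis by blast
  qed
  moreover have "Z \<noteq> X"
  proof -
    obtain u where "u \<in> U" using U(2) by blast
    \<comment> \<open>Time 0 counts as a visit, so a point of \<open>U\<close> itself shows that
      \<open>Z\<close> is proper.\<close>
    then have "u \<in> X" "u \<in> V 0" using openin_imp_subset[OF U(1)] by (auto simp: V_def)
    then show ?thesis by (auto simp: Z_def)
  qed
  ultimately have "Z = {}"
    using assms(1) by (auto simp: minimal_system_def subsystem_def)
  then obtain N where "X \<subseteq> V N"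
    using compact_increasing_open_cover[OF comp openV \<open>mono V\<close>] by (auto simp: Z_def)
  then show ?thesis by (force simp: V_def)
qed

section \<open>Uniformity of proximality\<close>

text \<open>If every term were at least \<open>\<delta>\<close>, so would be the limit
  inferior.\<close>

lemma proximal_pair_close:
  assumes "proximal_pair T x y" "\<delta> > 0"
  shows "\<exists>k. dist ((T ^^ k) x) ((T ^^ k) y) < \<delta>"
proof (rule ccontr)
  assume "\<not> ?thesis"
  then have "ereal \<delta> \<le> liminf (\<lambda>k. ereal (dist ((T ^^ k) x) ((T ^^ k) y)))"
    by (intro Liminf_bounded) (simp add: not_less)
  then show False using assms by (simp add: proximal_pair_def)
qed

lemma proximal_uniform_close:
  assumes sys: "dynamical_system X T" and contp: "continuous_on X p"
    and prox: "proximal_map p X T" and "\<delta> > 0"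
  shows "\<exists>N::nat. \<forall>x\<in>X. \<forall>y\<in>X. dist (p x) (p y) \<le> 1 / Suc N \<longrightarrow>
    (\<exists>k\<le>N. dist ((T ^^ k) x) ((T ^^ k) y) < \<delta>)"
proof -
  have comp: "compact X" and cont: "continuous_on X T" and TX: "T ` X \<subseteq> X"
    using sys by (auto simp: dynamical_system_def)
  have dist_cont: "continuous_on (X \<times> X) (\<lambda>z. dist (f (fst z)) (f (snd z)))"
    if "continuous_on X f" for f :: "'a \<Rightarrow> 'c::metric_space"
    using that by (intro continuous_intros continuous_on_compose2[OF that]) auto
  define A where "A k = (X \<times> X) \<inter> (\<lambda>z. dist ((T ^^ k) (fst z)) ((T ^^ k) (snd z))) -` {..<\<delta>}" for k
  define B where "B N = (X \<times> X) \<inter> (\<lambda>z. dist (p (fst z)) (p (snd z))) -` {1 / real (Suc N)<..}" for N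
  \<comment> \<open>The same \<open>N\<close> bounds the waiting time and sets the distance
    threshold, so these sets increase with \<open>N\<close>. They cover all pairs: proximality puts
    a pair in a common fibre into some \<open>A k\<close>, and any other pair lies in some
    \<open>B N\<close>.\<close>
  define V where "V N = (\<Union>k\<le>N. A k) \<union> B N" for N
  have openA: "openin (top_of_set (X \<times> X)) (A k)" for k
    unfolding A_def
    by (intro continuous_openin_preimage_gen dist_cont continuous_on_funpow[OF cont TX] open_lessThan)
  have openB: "openin (top_of_set (X \<times> X)) (B N)" for N
    unfolding B_def by (intro continuous_openin_preimage_gen dist_cont contp open_greaterThan)
  have openV: "openin (top_of_set (X \<times> X)) (V N)" for N
    unfolding V_def using openA openB by (intro openin_Un openin_Union) auto
  have "mono V"
  proof (rule monoI)
    fix M N :: nat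
    assume "M \<le> N"
    then have "1 / real (Suc N) \<le> 1 / real (Suc M)" by (simp add: frac_le)
    then have "B M \<subseteq> B N" unfolding B_def by auto
    moreover have "(\<Union>k\<le>M. A k) \<subseteq> (\<Union>k\<le>N. A k)" using \<open>M \<le> N\<close> by fastforce
    ultimately show "V M \<subseteq> V N" unfolding V_def by blast
  qed
  have cover: "X \<times> X \<subseteq> (\<Union>N. V N)"
  proof
    fix z
    assume z: "z \<in> X \<times> X"
    show "z \<in> (\<Union>N. V N)"
    proof (cases "p (fst z) = p (snd z)")
      case True
      then have "proximal_pair T (fst z) (snd z)"
        using prox z by (auto simp: proximal_map_def)
      then obtain k where "dist ((T ^^ k) (fst z)) ((T ^^ k) (snd z)) < \<delta>"
        using proximal_pair_close \<open>\<delta> > 0\<close> by blast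
      then have "z \<in> A k" using z by (auto simp: A_def)
      then show ?thesis by (auto simp: V_def)
    next
      case False
      then obtain N where "1 / real (Suc N) < dist (p (fst z)) (p (snd z))"
        using nat_approx_posE[of "dist (p (fst z)) (p (snd z))"] by auto
      then have "z \<in> B N" using z by (auto simp: B_def)
      then show ?thesis by (auto simp: V_def)
    qed
  qed
  obtain N where N: "X \<times> X \<subseteq> V N"
    using compact_increasing_open_cover[OF compact_Times[OF comp comp] openV \<open>mono V\<close> cover]
    by blast
  have "\<exists>k\<le>N. dist ((T ^^ k) x) ((T ^^ k) y) < \<delta>"
    if "x \<in> X" "y \<in> X" "dist (p x) (p y) \<le> 1 / Suc N" for x y
  proof -
    have "(x, y) \<in> V N" using N that by blast
    then show ?thesis using that(3) by (auto simp: V_def A_def B_def)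
  qed
  then show ?thesis by blast
qed

section \<open>Transfer of sensitivity in both directions\<close>

lemma tuplewise_thickly_sensitive_iff:
  assumes "n \<ge> 2"
  shows "tuplewise_thickly_sensitive n X T \<longleftrightarrow>
    (\<exists>\<delta>>0. \<forall>U. openin (top_of_set X) U \<and> U \<noteq> {} \<longrightarrow>
      (\<exists>x. (\<forall>i\<in>{1..n}. x i \<in> U) \<and>
        thick {k. k \<ge> 1 \<and> (\<forall>i j. 1 \<le> i \<and> i < j \<and> j \<le> n \<longrightarrow>
          dist ((T ^^ k) (x i)) ((T ^^ k) (x j)) > \<delta>)}))"
  unfolding tuplewise_thickly_sensitive_def
  by (simp only: Min_pair_dist_gt_iff[OF assms])

lemma thickly_sensitive_proximal_factor:
  assumes sys: "dynamical_system X T" and fac: "factor_map p X T Y S"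
    and prox: "proximal_map p X T" and n: "n \<ge> 2"
    and sens: "tuplewise_thickly_sensitive n X T"
  shows "tuplewise_thickly_sensitive n Y S"
proof -
  have TX: "T ` X \<subseteq> X" using sys by (simp add: dynamical_system_def)
  have contp: "continuous_on X p" and pX: "p ` X = Y" and comm: "\<forall>x\<in>X. p (T x) = S (p x)"
    using fac by (auto simp: factor_map_def)
  obtain \<delta> where "\<delta> > 0" and \<delta>: "\<And>U. openin (top_of_set X) U \<Longrightarrow> U \<noteq> {} \<Longrightarrow>
      \<exists>x. (\<forall>i\<in>{1..n}. x i \<in> U) \<and>
        thick {k. k \<ge> 1 \<and> (\<forall>i j. 1 \<le> i \<and> i < j \<and> j \<le> n \<longrightarrow>
          dist ((T ^^ k) (x i)) ((T ^^ k) (x j)) > \<delta>)}"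
    using sens unfolding tuplewise_thickly_sensitive_iff[OF n] by blast
  obtain N :: nat where N: "\<And>x y. x \<in> X \<Longrightarrow> y \<in> X \<Longrightarrow> dist (p x) (p y) \<le> 1 / Suc N \<Longrightarrow>
      \<exists>k\<le>N. dist ((T ^^ k) x) ((T ^^ k) y) < \<delta>"
    using proximal_uniform_close[OF sys contp prox \<open>\<delta> > 0\<close>] by blast
  show ?thesis
    unfolding tuplewise_thickly_sensitive_iff[OF n]
  proof (intro exI[of _ "1 / real (Suc N)"] conjI allI impI)
    fix V
    assume V: "openin (top_of_set Y) V \<and> V \<noteq> {}"
    \<comment> \<open>A separated tuple in this preimage maps under \<open>p\<close> to a tuple in
      \<open>V\<close>.\<close>
    define U where "U = X \<inter> p -` V"
    have "openin (top_of_set X) U"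
      unfolding U_def using V contp pX by (intro continuous_openin_preimage[where T = Y]) auto
    moreover have "U \<noteq> {}"
    proof -
      obtain y where "y \<in> V" using V by blast
      then have "y \<in> p ` X" using V pX openin_imp_subset by blast
      then show ?thesis using \<open>y \<in> V\<close> by (auto simp: U_def)
    qed
    ultimately obtain x where xU: "\<forall>i\<in>{1..n}. x i \<in> U"
      and th: "thick {k. k \<ge> 1 \<and> (\<forall>i j. 1 \<le> i \<and> i < j \<and> j \<le> n \<longrightarrow>
          dist ((T ^^ k) (x i)) ((T ^^ k) (x j)) > \<delta>)}" (is "thick ?F")
      using \<delta> by blast
    show "\<exists>y. (\<forall>i\<in>{1..n}. y i \<in> V) \<and>
        thick {k. k \<ge> 1 \<and> (\<forall>i j. 1 \<le> i \<and> i < j \<and> j \<le> n \<longrightarrow>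
          dist ((S ^^ k) (y i)) ((S ^^ k) (y j)) > 1 / real (Suc N))}"
    proof (intro exI[of _ "p \<circ> x"] conjI)
      show "\<forall>i\<in>{1..n}. (p \<circ> x) i \<in> V" using xU by (auto simp: U_def)
      show "thick {k. k \<ge> 1 \<and> (\<forall>i j. 1 \<le> i \<and> i < j \<and> j \<le> n \<longrightarrow>
          dist ((S ^^ k) ((p \<circ> x) i)) ((S ^^ k) ((p \<circ> x) j)) > 1 / real (Suc N))}"
        using th
      proof (rule thick_from_blocks[where c = N], intro CollectI conjI allI impI)
        fix k i j
        assume F: "{k..k + N} \<subseteq> ?F" and ij: "1 \<le> i \<and> i < j \<and> j \<le> n"
        then have xX: "x i \<in> X" "x j \<in> X" using xU by (auto simp: U_def)
        show "dist ((S ^^ k) ((p \<circ> x) i)) ((S ^^ k) ((p \<circ> x) j)) > 1 / real (Suc N)"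
        proof (rule ccontr)
          assume "\<not> ?thesis"
          then have "dist (p ((T ^^ k) (x i))) (p ((T ^^ k) (x j))) \<le> 1 / Suc N"
            using xX by (simp add: factor_funpow[OF comm TX])
          then obtain l where l: "l \<le> N"
            "dist ((T ^^ l) ((T ^^ k) (x i))) ((T ^^ l) ((T ^^ k) (x j))) < \<delta>"
            using N xX funpow_mem[OF TX] by blast
          \<comment> \<open>The whole block is required because \<open>l\<close> depends on the pair
            and on \<open>k\<close>; only the bound l \<le> N is known.\<close>
          have "k + l \<in> ?F" using l(1) by (intro subsetD[OF F]) simp
          then have "dist ((T ^^ (l + k)) (x i)) ((T ^^ (l + k)) (x j)) > \<delta>"
            using ij by (simp add: add.commute)
          then show False using l(2) by (simp add: funpow_add)
        qed
      qed simp
    qed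
  qed simp
qed

lemma thickly_sensitive_extension:
  assumes minX: "minimal_system X T" and fac: "factor_map p X T Y S"
    and sysY: "dynamical_system Y S" and n: "n \<ge> 2"
    and sens: "tuplewise_thickly_sensitive n Y S"
  shows "tuplewise_thickly_sensitive n X T"
proof -
  have compX: "compact X" and TX: "T ` X \<subseteq> X"
    using minX by (auto simp: minimal_system_def dynamical_system_def)
  have contS: "continuous_on Y S" and SY: "S ` Y \<subseteq> Y"
    using sysY by (auto simp: dynamical_system_def)
  have contp: "continuous_on X p" and pX: "p ` X = Y" and comm: "\<forall>x\<in>X. p (T x) = S (p x)"
    using fac by (auto simp: factor_map_def)
  obtain \<epsilon> where "\<epsilon> > 0" and \<epsilon>: "\<And>V. openin (top_of_set Y) V \<Longrightarrow> V \<noteq> {} \<Longrightarrow>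
      \<exists>y. (\<forall>i\<in>{1..n}. y i \<in> V) \<and>
        thick {k. k \<ge> 1 \<and> (\<forall>i j. 1 \<le> i \<and> i < j \<and> j \<le> n \<longrightarrow>
          dist ((S ^^ k) (y i)) ((S ^^ k) (y j)) > \<epsilon>)}"
    using sens unfolding tuplewise_thickly_sensitive_iff[OF n] by blast
  have "uniformly_continuous_on X p"
    using contp compX by (rule compact_uniformly_continuous)
  then obtain \<eta> where "\<eta> > 0"
    and \<eta>: "\<And>x x'. x \<in> X \<Longrightarrow> x' \<in> X \<Longrightarrow> dist x x' < \<eta> \<Longrightarrow> dist (p x) (p x') < \<epsilon>"
    using \<open>\<epsilon> > 0\<close> unfolding uniformly_continuous_on_def by metis
  show ?thesis
    unfolding tuplewise_thickly_sensitive_iff[OF n]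
  \<comment> \<open>Uniform continuity only yields distance at least \<open>\<eta>\<close>, while
    sensitivity asks for a strict inequality; hence the half.\<close>
  proof (intro exI[of _ "\<eta> / 2"] conjI allI impI)
    fix U
    assume U: "openin (top_of_set X) U \<and> U \<noteq> {}"
    then obtain u where "u \<in> U" by blast
    then obtain r where "r > 0" and r: "cball u r \<inter> X \<subseteq> U"
      using U by (meson openin_contains_cball)
    have uX: "u \<in> X" using U \<open>u \<in> U\<close> openin_imp_subset by blast
    \<comment> \<open>The closed ball makes \<open>K\<close> and its image under \<open>p\<close>
      compact, so the sets \<open>C k\<close> below are closed. The open ball inside it is the
      target that orbits must hit.\<close>
    define K where "K = X \<inter> cball u r"
    have "compact K" unfolding K_def using compX by (intro compact_Int_closed) auto
    have "openin (top_of_set X) (X \<inter> ball u r)" by (simp add: openin_open_Int)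
    moreover have "X \<inter> ball u r \<noteq> {}" using uX \<open>r > 0\<close> by auto
    ultimately obtain N where N: "\<And>x. x \<in> X \<Longrightarrow> \<exists>k\<le>N. (T ^^ k) x \<in> X \<inter> ball u r"
      using minimal_hitting_time_bound[OF minX] by meson
    define C where "C k = Y \<inter> (S ^^ k) -` (p ` K)" for k
    have closedC: "closedin (top_of_set Y) (C k)" for k
    proof -
      have "compact (p ` K)"
        using \<open>compact K\<close> continuous_on_subset[OF contp]
        by (intro compact_continuous_image) (auto simp: K_def)
      then show ?thesis
        unfolding C_def using continuous_on_funpow[OF contS SY]
        by (intro continuous_closedin_preimage compact_imp_closed)
    qed
    \<comment> \<open>Lift a point of \<open>Y\<close> to \<open>X\<close>: its orbit enters the
      open ball by time \<open>N\<close>, and \<open>p\<close> carries this visit down to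
      \<open>Y\<close>.\<close>
    have "Y \<subseteq> (\<Union>k<Suc N. C k)"
    proof
      fix y
      assume "y \<in> Y"
      then obtain x where x: "x \<in> X" "y = p x" using pX by blast
      obtain k where k: "k \<le> N" "(T ^^ k) x \<in> X \<inter> ball u r" using N x(1) by blast
      have "(S ^^ k) y = p ((T ^^ k) x)" using factor_funpow[OF comm TX x(1)] x(2) by simp
      then have "y \<in> C k" using k(2) \<open>y \<in> Y\<close> by (auto simp: C_def K_def)
      then show "y \<in> (\<Union>k<Suc N. C k)" using k(1) by (auto simp: less_Suc_eq_le)
    qed
    moreover have "Y \<noteq> {}" using uX pX by blast
    ultimately have "\<exists>c V. openin (top_of_set Y) V \<and> V \<noteq> {} \<and> V \<subseteq> C c"
      using closedC by (intro finite_closed_cover_contains_open[of Y C Y "Suc N"]) auto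
    then obtain c V where V: "openin (top_of_set Y) V" "V \<noteq> {}" "V \<subseteq> C c"
      by blast
    obtain y where yV: "\<forall>i\<in>{1..n}. y i \<in> V"
      and th: "thick {k. k \<ge> 1 \<and> (\<forall>i j. 1 \<le> i \<and> i < j \<and> j \<le> n \<longrightarrow>
          dist ((S ^^ k) (y i)) ((S ^^ k) (y j)) > \<epsilon>)}" (is "thick ?F")
      using \<epsilon>[OF V(1,2)] by blast
    \<comment> \<open>What is lifted is the tuple after \<open>c\<close> steps: \<open>y i\<close>
      itself need not have a preimage in \<open>U\<close>, but V \<subseteq> C c provides one in
      \<open>K\<close> for its \<open>c\<close>-th iterate.\<close>
    have "\<forall>i\<in>{1..n}. \<exists>z. z \<in> K \<and> p z = (S ^^ c) (y i)"
      using yV V(3) by (fastforce simp: C_def)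
    then obtain x where x: "\<forall>i\<in>{1..n}. x i \<in> K \<and> p (x i) = (S ^^ c) (y i)"
      by metis
    show "\<exists>x. (\<forall>i\<in>{1..n}. x i \<in> U) \<and>
        thick {k. k \<ge> 1 \<and> (\<forall>i j. 1 \<le> i \<and> i < j \<and> j \<le> n \<longrightarrow>
          dist ((T ^^ k) (x i)) ((T ^^ k) (x j)) > \<eta> / 2)}"
    proof (intro exI[of _ x] conjI)
      show "\<forall>i\<in>{1..n}. x i \<in> U" using x r by (auto simp: K_def)
      show "thick {k. k \<ge> 1 \<and> (\<forall>i j. 1 \<le> i \<and> i < j \<and> j \<le> n \<longrightarrow>
          dist ((T ^^ k) (x i)) ((T ^^ k) (x j)) > \<eta> / 2)}"
        using th
      proof (rule thick_from_blocks[where c = c], intro CollectI conjI allI impI)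
        fix k i j
        assume F: "{k..k + c} \<subseteq> ?F" and ij: "1 \<le> i \<and> i < j \<and> j \<le> n"
        have xX: "x i \<in> X" "x j \<in> X" using ij x by (auto simp: K_def)
        \<comment> \<open>Because of the shift, time \<open>k\<close> upstairs corresponds to time k
          + c downstairs, the right endpoint of the block.\<close>
        have img: "p ((T ^^ k) (x l)) = (S ^^ (k + c)) (y l)" if "l \<in> {1..n}" for l
          using that x factor_funpow[OF comm TX, of "x l" k] by (simp add: K_def funpow_add)
        have "k + c \<in> ?F" by (intro subsetD[OF F]) simp
        then have "dist ((S ^^ (k + c)) (y i)) ((S ^^ (k + c)) (y j)) > \<epsilon>" using ij by blast
        then have "dist (p ((T ^^ k) (x i))) (p ((T ^^ k) (x j))) > \<epsilon>"
          using img[of i] img[of j] ij by simp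
        then have "\<not> dist ((T ^^ k) (x i)) ((T ^^ k) (x j)) < \<eta>"
          using \<eta> xX funpow_mem[OF TX] by (meson less_asym)
        then show "dist ((T ^^ k) (x i)) ((T ^^ k) (x j)) > \<eta> / 2"
          using \<open>\<eta> > 0\<close> by simp
      qed simp
    qed
  qed (use \<open>\<eta> > 0\<close> in simp)
qed

theorem corollary4p9:
  fixes X :: "'a::metric_space set" and T :: "'a \<Rightarrow> 'a"
    and Y :: "'b::metric_space set" and S :: "'b \<Rightarrow> 'b"
    and p :: "'a \<Rightarrow> 'b" and n :: nat
  assumes "minimal_system X T" and "minimal_system Y S"
    and "factor_map p X T Y S"
    and "proximal_map p X T"
    and "n \<ge> 2"
  shows "tuplewise_thickly_sensitive n X T \<longleftrightarrow> tuplewise_thickly_sensitive n Y S"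
proof -
  have "dynamical_system X T" "dynamical_system Y S"
    using assms(1,2) by (simp_all add: minimal_system_def)
  then show ?thesis
    using thickly_sensitive_proximal_factor thickly_sensitive_extension assms by metis
qed

end
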